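(* Let $p\in[1,\infty)$, $\rho\in(0,1]$, $\kappa\in(0,1)$, $C_g\in[1,\infty)$, and $\beta,\gamma\in[0,\infty)$. For every $d\ge2$ let $g_d\colon\mathbb R^{d-1}\to\mathbb R$ be continuous and assume that $$|g_d(z)|\le C_gd^\beta\quad\text{for }z\in\mathbb R^{d-1},$$ $$|g_d(z_1)-g_d(z_2)|\le C_gd^\beta R^\gamma\|z_1-z_2\|_{\mathbb R^{d-1}}^\rho\quad\text{for }R\ge1\text{ and }z_1,z_2\in[-R,R]^{d-1}.$$ Let $H_d=\mathbb R^{d-1}\times(0,\infty)$ and let $u_d\colon H_d\to\mathbb R$ be the Poisson extension of $g_d$, $$u_d(x',x_d)=\int_{\mathbb R^{d-1}}g_d(y)\,\frac{\Gamma(d/2)}{\pi^{d/2}}\,\frac{x_d}{\big(\|x'-y\|_{\mathbb R^{d-1}}^2+x_d^2\big)^{d/2}}\,dy,\qquad(x',x_d)\in H_d,$$ and let $D_{d,\kappa}:=[-1/2,1/2]^{d-1}\times[\kappa,1]\subset H_d$. Then there exist constants $C,\alpha\in(0,\infty)$, depending only on $p,\rho,\kappa,C_g,\beta,\gamma$, such that for every $d\ge2$ and every $\varepsilon\in(0,1]$ there exists a finite expression $\Psi_{d,\varepsilon}\colon\mathbb R^d\to\mathbb R$ over $\mathcal D_0$ satisfying $$\|u_d-\Psi_{d,\varepsilon}\|_{L^p(D_{d,\kappa})}\le\varepsilon\quad\text{and}\quad\operatorname{Cost}(\Psi_{d,\varepsilon})\le Cd^\alpha\varepsilon^{-\alpha}.$$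 In particular, the family $u_d$ admits finite expression approximations on $D_{d,\kappa}$ with evaluation cost at most polynomial in $d$ and $\varepsilon^{-1}$.
   Context: Dictionary: $\mathcal D_0=\{+,-,\times,/,\max\{0,\cdot\},\sin(\cdot),2^{(\cdot)}\}$. A finite expression over $\mathcal D_0$ is a function built from the input coordinates and fixed real constants by finitely many operations from $\mathcal D_0$ (denominators must be nonzero on the domain considered). Each scalar operation has unit cost; reading coordinates and constants has zero cost; computed values may be reused; $\operatorname{Cost}(\Phi)$ is the number of operations in one evaluation of $\Phi$. The function $u_d$ is bounded and harmonic in $H_d$ and satisfies $\lim_{x_d\downarrow0}u_d(x',x_d)=g_d(x')$ for $x'\in\mathbb R^{d-1}$. Equivalently $u_d(x',x_d)=\mathbb E[g_d(x'+x_dC_d)]$, where $C_d$ is an $\mathbb R^{d-1}$-valued random variable with density $q_d(z)=\frac{\Gamma(d/2)}{\pi^{d/2}}(1+\|z\|^2_{\mathbb R^{d-1}})^{-d/2}$. *)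

theory Defs
  imports "HOL-Analysis.Analysis" "HOL-Computational_Algebra.Polynomial"
begin

text \<open>
  The dimension is quantified inside the theorem, so vectors of length \<open>n\<close> are extensional
  functions on \<open>{..<n}\<close>. This is exactly the space of the product measure \<open>leb n\<close>, and the
  product topology on \<open>nat \<Rightarrow> real\<close> restricts to the Euclidean topology on it.
  The norm is \<^const>\<open>L2_set\<close> over \<open>{..<n}\<close>. In dimension \<open>d\<close>, a point \<open>x\<close> stands for the pair
  consisting of \<open>x' = restrict x {..<d - 1}\<close> and of the last coordinate \<open>x (d - 1)\<close>.
\<close>

definition Rn :: "nat \<Rightarrow> (nat \<Rightarrow> real) set" where
  "Rn n = {..<n} \<rightarrow>\<^sub>E UNIV"

definition cube :: "nat \<Rightarrow> real \<Rightarrow> (nat \<Rightarrow> real) set" where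
  "cube n R = {..<n} \<rightarrow>\<^sub>E {-R..R}"

definition leb :: "nat \<Rightarrow> (nat \<Rightarrow> real) measure" where
  "leb n = PiM {..<n} (\<lambda>_. lborel)"

definition ndist :: "nat \<Rightarrow> (nat \<Rightarrow> real) \<Rightarrow> (nat \<Rightarrow> real) \<Rightarrow> real" where
  "ndist n x y = L2_set (\<lambda>i. x i - y i) {..<n}"

text \<open>Integrability is part of membership, so that the Bochner integral in the norm is never
  the default value 0 of a non-integrable function.\<close>

definition in_Lp :: "real \<Rightarrow> 'a measure \<Rightarrow> ('a \<Rightarrow> real) \<Rightarrow> bool" where
  "in_Lp p M f \<longleftrightarrow> f \<in> borel_measurable M \<and> integrable M (\<lambda>x. \<bar>f x\<bar> powr p)"

definition Lp_norm :: "real \<Rightarrow> 'a measure \<Rightarrow> ('a \<Rightarrow> real) \<Rightarrow> real" where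
  "Lp_norm p M f = (LINT x|M. \<bar>f x\<bar> powr p) powr (1 / p)"

definition boundary_data ::
    "real \<Rightarrow> real \<Rightarrow> real \<Rightarrow> real \<Rightarrow> nat \<Rightarrow> ((nat \<Rightarrow> real) \<Rightarrow> real) \<Rightarrow> bool" where
  "boundary_data \<rho> Cg \<beta> \<gamma> d g \<longleftrightarrow>
     continuous_on (Rn (d - 1)) g \<and>
     (\<forall>z\<in>Rn (d - 1). \<bar>g z\<bar> \<le> Cg * real d powr \<beta>) \<and>
     (\<forall>R\<ge>1. \<forall>z1\<in>cube (d - 1) R. \<forall>z2\<in>cube (d - 1) R.
        \<bar>g z1 - g z2\<bar> \<le> Cg * real d powr \<beta> * R powr \<gamma> * ndist (d - 1) z1 z2 powr \<rho>)"

definition poisson_extension ::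
    "nat \<Rightarrow> ((nat \<Rightarrow> real) \<Rightarrow> real) \<Rightarrow> (nat \<Rightarrow> real) \<Rightarrow> real" where
  "poisson_extension d g x =
     (LINT y|leb (d - 1).
        g y * (Gamma (real d / 2) / pi powr (real d / 2)) *
        (x (d - 1) / ((ndist (d - 1) x y)\<^sup>2 + (x (d - 1))\<^sup>2) powr (real d / 2)))"

definition slab :: "nat \<Rightarrow> real \<Rightarrow> (nat \<Rightarrow> real) set" where
  "slab d \<kappa> = (\<Pi>\<^sub>E i\<in>{..<d}. if i < d - 1 then {-1/2..1/2} else {\<kappa>..1})"

text \<open>
  Since computed values may be reused at no cost, a finite expression is a straight-line program:
  every instruction applies one dictionary operation and appends its value to the list of
  computed values, and \<open>Val j\<close> refers to the \<open>j\<close>-th of these values.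
\<close>

datatype operand = Coord nat | Const real | Val nat

datatype instr =
    Add operand operand
  | Sub operand operand
  | Mul operand operand
  | Div operand operand
  | Relu operand
  | Sin operand
  | Exp2 operand

datatype fex = Fex (instrs: "instr list") (result: operand)

primrec operand_val :: "(nat \<Rightarrow> real) \<Rightarrow> real list \<Rightarrow> operand \<Rightarrow> real" where
  "operand_val x vs (Coord i) = x i"
| "operand_val x vs (Const c) = c"
| "operand_val x vs (Val j) = vs ! j"

primrec instr_val :: "(nat \<Rightarrow> real) \<Rightarrow> real list \<Rightarrow> instr \<Rightarrow> real" where
  "instr_val x vs (Add a b) = operand_val x vs a + operand_val x vs b"
| "instr_val x vs (Sub a b) = operand_val x vs a - operand_val x vs b"
| "instr_val x vs (Mul a b) = operand_val x vs a * operand_val x vs b"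
| "instr_val x vs (Div a b) = operand_val x vs a / operand_val x vs b"
| "instr_val x vs (Relu a) = max 0 (operand_val x vs a)"
| "instr_val x vs (Sin a) = sin (operand_val x vs a)"
| "instr_val x vs (Exp2 a) = 2 powr (operand_val x vs a)"

primrec run :: "(nat \<Rightarrow> real) \<Rightarrow> real list \<Rightarrow> instr list \<Rightarrow> real list" where
  "run x vs [] = vs"
| "run x vs (c # cs) = run x (vs @ [instr_val x vs c]) cs"

definition fex_val :: "fex \<Rightarrow> (nat \<Rightarrow> real) \<Rightarrow> real" where
  "fex_val \<Phi> x = operand_val x (run x [] (instrs \<Phi>)) (result \<Phi>)"

definition fex_cost :: "fex \<Rightarrow> nat" where
  "fex_cost \<Phi> = length (instrs \<Phi>)"

text \<open>In \<open>operand_ok d k\<close>, \<open>k\<close> is the number of values computed so far.\<close>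

primrec operand_ok :: "nat \<Rightarrow> nat \<Rightarrow> operand \<Rightarrow> bool" where
  "operand_ok d k (Coord i) \<longleftrightarrow> i < d"
| "operand_ok d k (Const c) \<longleftrightarrow> True"
| "operand_ok d k (Val j) \<longleftrightarrow> j < k"

primrec instr_ok :: "nat \<Rightarrow> (nat \<Rightarrow> real) \<Rightarrow> real list \<Rightarrow> instr \<Rightarrow> bool" where
  "instr_ok d x vs (Add a b) \<longleftrightarrow> operand_ok d (length vs) a \<and> operand_ok d (length vs) b"
| "instr_ok d x vs (Sub a b) \<longleftrightarrow> operand_ok d (length vs) a \<and> operand_ok d (length vs) b"
| "instr_ok d x vs (Mul a b) \<longleftrightarrow> operand_ok d (length vs) a \<and> operand_ok d (length vs) b"
| "instr_ok d x vs (Div a b) \<longleftrightarrow>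
     operand_ok d (length vs) a \<and> operand_ok d (length vs) b \<and> operand_val x vs b \<noteq> 0"
| "instr_ok d x vs (Relu a) \<longleftrightarrow> operand_ok d (length vs) a"
| "instr_ok d x vs (Sin a) \<longleftrightarrow> operand_ok d (length vs) a"
| "instr_ok d x vs (Exp2 a) \<longleftrightarrow> operand_ok d (length vs) a"

primrec run_ok :: "nat \<Rightarrow> (nat \<Rightarrow> real) \<Rightarrow> real list \<Rightarrow> instr list \<Rightarrow> bool" where
  "run_ok d x vs [] \<longleftrightarrow> True"
| "run_ok d x vs (c # cs) \<longleftrightarrow>
     instr_ok d x vs c \<and> run_ok d x (vs @ [instr_val x vs c]) cs"

text \<open>Denominators must be nonzero on all of \<open>d\<close>-dimensional space, not only on the domain of
  approximation.\<close>

definition finite_expression :: "nat \<Rightarrow> fex \<Rightarrow> bool" where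
  "finite_expression d \<Phi> \<longleftrightarrow>
     (\<forall>x\<in>Rn d. run_ok d x [] (instrs \<Phi>)) \<and>
     operand_ok d (length (instrs \<Phi>)) (result \<Phi>)"

definition Lp_approximates ::
    "real \<Rightarrow> nat \<Rightarrow> (nat \<Rightarrow> real) set \<Rightarrow> ((nat \<Rightarrow> real) \<Rightarrow> real) \<Rightarrow> real \<Rightarrow> fex \<Rightarrow> bool" where
  "Lp_approximates p d D u \<epsilon> \<Psi> \<longleftrightarrow>
     in_Lp p (restrict_space (leb d) D) (\<lambda>x. u x - fex_val \<Psi> x) \<and>
     Lp_norm p (restrict_space (leb d) D) (\<lambda>x. u x - fex_val \<Psi> x) \<le> \<epsilon>"

end

theory Submission
  imports Defs "HOL-Probability.Distributions"
begin

text \<open>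
  On the slab the Poisson extension is bounded by the bound \<open>G\<close> of the boundary values, because the
  Poisson kernel is a probability density (\<open>nn_integral_poisson_kernel\<close>). It also varies slowly: the
  height and the distance to a boundary point are at least \<open>\<kappa>\<close>, so a shift of every coordinate by at
  most \<open>h\<close> changes the kernel by a factor of at most \<open>exp (2 * d\<^sup>2 * h / \<kappa>)\<close>, uniformly in the boundary
  point (\<open>poisson_kernel_Harnack\<close>). Hence the Lipschitz constant is at most a multiple of
  \<open>G * d\<^sup>2 / \<kappa>\<close> (\<open>poisson_extension_Lipschitz\<close>), and up to an error \<open>\<epsilon> / 4\<close> the extension is constant
  on the cells of a grid with \<open>N\<close> cells per unit length, where \<open>N\<close> is polynomial in \<open>d\<close> and
  \<open>1 / \<epsilon>\<close>.

  The grid has exponentially many cells, but the cost of an expression counts its operations and not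
  the size of its constants. Each of the \<open>2 * d * N\<close> comparisons of a coordinate with a threshold costs
  a few operations, if the step function is replaced by a steep ramp. The binary number formed by the
  outcomes is an address \<open>k\<close> that determines the cell, and the values on all cells can be stored in a
  single real constant: for every table \<open>y\<close> with entries between \<open>-1\<close> and \<open>1\<close> there is a \<open>w\<close> such
  that \<open>sin (w * L ^ k)\<close> is close to \<open>y k\<close> for all \<open>k\<close> (\<open>sin_interpolates\<close>). With \<open>L\<close> a power of two,
  the entry at address \<open>k\<close> is read with one exponential and one sine.

  The ramps fail to give a bit only on thin strips around the thresholds. The program is bounded
  everywhere, and the slope of the ramps can be chosen last, so the strips contribute as little as desired
  to the \<open>L\<^sup>p\<close> norm (\<open>Lp_approximation_on_slab\<close>).
\<close>

section \<open>A program that computes a binary address and looks up a value\<close>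

lemma run_append: "run x vs (cs @ ds) = run x (run x vs cs) ds"
  by (induction cs arbitrary: vs) auto

lemma run_ok_append:
  "run_ok d x vs (cs @ ds) \<longleftrightarrow> run_ok d x vs cs \<and> run_ok d x (run x vs cs) ds"
  by (induction cs arbitrary: vs) auto

text \<open>
  A continuous substitute for the unit step at 0: it leaves the values 0 and 1 only on the open
  interval from 0 to 1, which becomes arbitrarily short once the argument is scaled by a large
  constant.
\<close>
definition ramp :: "real \<Rightarrow> real" where
  "ramp c = max 0 c - max 0 (c - 1)"

text \<open>
  The test \<open>(i, a)\<close> asks whether the coordinate \<open>x i\<close> exceeds the threshold \<open>a\<close>.
\<close>
definition ramp_bit :: "real \<Rightarrow> (nat \<Rightarrow> real) \<Rightarrow> nat \<times> real \<Rightarrow> real" where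
  "ramp_bit K x t = ramp ((x (fst t) - snd t) * K)"

text \<open>
  The number with binary digits \<open>bs\<close>, most significant digit first. Doubling is written as a sum
  because this is the operation that the program performs; the start value makes the induction over
  the digits go through.
\<close>
definition horner :: "'a :: comm_semiring_1 \<Rightarrow> 'a list \<Rightarrow> 'a" where
  "horner a bs = foldl (\<lambda>s b. s + s + b) a bs"

lemma horner_simps [simp]:
  "horner a [] = a" "horner a (b # bs) = horner (a + a + b) bs"
  by (simp_all add: horner_def)

text \<open>
  Eight operations per test: six for the ramp and two for the Horner step. The argument \<open>n\<close> is the
  number of values already computed, so that the accumulator of the Horner scheme is always
  \<open>Val (n - 1)\<close>.
\<close>
primrec address_code :: "real \<Rightarrow> nat \<Rightarrow> (nat \<times> real) list \<Rightarrow> instr list" where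
  "address_code K n [] = []"
| "address_code K n (t # ts) =
     [Sub (Coord (fst t)) (Const (snd t)),
      Mul (Val n) (Const K),
      Relu (Val (n + 1)),
      Sub (Val (n + 1)) (Const 1),
      Relu (Val (n + 3)),
      Sub (Val (n + 2)) (Val (n + 4)),
      Add (Val (n - 1)) (Val (n - 1)),
      Add (Val (n + 6)) (Val (n + 5))] @ address_code K (n + 8) ts"

lemma length_address_code [simp]: "length (address_code K n ts) = 8 * length ts"
  by (induction ts arbitrary: n) auto

lemma run_address_code:
  assumes "vs \<noteq> []" "n = length vs"
  shows "length (run x vs (address_code K n ts)) = n + 8 * length ts"
    and "run x vs (address_code K n ts) ! (n + 8 * length ts - 1) =
           horner (vs ! (n - 1)) (map (ramp_bit K x) ts)"
    and "\<forall>t\<in>set ts. fst t < d \<Longrightarrow> run_ok d x vs (address_code K n ts)"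
  using assms
proof (induction ts arbitrary: n vs)
  case Nil
  { case 1 thus ?case by simp }
  { case 2 thus ?case by simp }
  { case 3 thus ?case by simp }
next
  case (Cons t ts)
  note IH = Cons.IH
  (* the list of values after the eight operations of the first test *)
  define ws where "ws vs = vs @
    [x (fst t) - snd t, (x (fst t) - snd t) * K, max 0 ((x (fst t) - snd t) * K),
     (x (fst t) - snd t) * K - 1, max 0 ((x (fst t) - snd t) * K - 1), ramp_bit K x t,
     vs ! (length vs - 1) + vs ! (length vs - 1),
     vs ! (length vs - 1) + vs ! (length vs - 1) + ramp_bit K x t]" for vs
  have len: "length (ws vs) = length vs + 8" for vs
    by (simp add: ws_def)
  have run: "run x vs (address_code K (length vs) (t # ts)) =
      run x (ws vs) (address_code K (length vs + 8) ts)" if "vs \<noteq> []" for vs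
    using that
    by (simp add: ws_def nth_append ramp_bit_def ramp_def)
  have ws_last: "ws vs ! (length vs + 8 - 1) =
      vs ! (length vs - 1) + vs ! (length vs - 1) + ramp_bit K x t" for vs
    by (simp add: ws_def nth_append)
  have ne: "ws vs \<noteq> []" for vs by (simp add: ws_def)
  { case 1 thus ?case using IH(1)[OF ne len[symmetric], of vs] run by (simp add: len) }
  { case 2 thus ?case using IH(2)[OF ne len[symmetric], of vs] run ws_last[of vs]
      by (simp add: add.assoc) }
  { case 3
    hence "run_ok d x (ws vs) (address_code K (n + 8) ts)"
      using IH(3)[OF _ ne, of "n + 8" vs] by (simp add: len)
    thus ?case using 3 by (simp add: ws_def nth_append ramp_bit_def ramp_def) }
qed

text \<open>
  Uniqueness of binary expansions. It is what makes the address of a point determine the outcome of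
  every single test.
\<close>
lemma horner_inj:
  assumes "length as = length bs" "set as \<subseteq> {0,1}" "set bs \<subseteq> {0,1}"
    and "horner c as = horner e bs"
  shows "as = bs \<and> c = (e::nat)"
  using assms
proof (induction as bs arbitrary: c e rule: list_induct2)
  case Nil
  then show ?case by simp
next
  case (Cons a as b bs)
  have "as = bs \<and> c + c + a = e + e + b"
    using Cons.IH[of "c + c + a" "e + e + b"] Cons.prems by auto
  moreover have "a = 0 \<or> a = 1" "b = 0 \<or> b = 1" using Cons.prems by auto
  ultimately show ?case by (auto; presburger)
qed

lemma horner_less:
  assumes "set bs \<subseteq> {0,1}"
  shows "horner (c::nat) bs < (c + 1) * 2 ^ length bs"
  using assms
proof (induction bs arbitrary: c)
  case (Cons b bs)
  have "horner (c + c + b) bs < (c + c + b + 1) * 2 ^ length bs"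
    using Cons.IH Cons.prems by auto
  also have "\<dots> \<le> (2 * (c + 1)) * 2 ^ length bs"
    using Cons.prems by (intro mult_right_mono) auto
  finally show ?case by (simp add: mult_ac)
qed simp

lemma horner_of_nat: "horner (of_nat c) (map of_nat bs) = of_nat (horner c bs)"
proof (induction bs arbitrary: c)
  case (Cons b bs)
  show ?case using Cons.IH[of "c + c + b"] by simp
qed simp

text \<open>
  The first instruction sets the accumulator to 0. Once the address \<open>k\<close> is computed, the last five
  operations evaluate \<open>B * sin (w * (2 ^ m) ^ k)\<close>, which reads entry \<open>k\<close> of a table encoded in the
  one real constant \<open>w\<close>.
\<close>
definition lookup_fex :: "real \<Rightarrow> (nat \<times> real) list \<Rightarrow> nat \<Rightarrow> real \<Rightarrow> real \<Rightarrow> fex" where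
  "lookup_fex K ts m w B =
     (let n = 8 * length ts + 1 in
      Fex (Add (Const 0) (Const 0) # address_code K 1 ts @
           [Mul (Const (real m)) (Val (n - 1)), Exp2 (Val n), Mul (Const w) (Val (n + 1)),
            Sin (Val (n + 2)), Mul (Const B) (Val (n + 3))])
          (Val (n + 4)))"

lemma lookup_fex:
  shows "fex_cost (lookup_fex K ts m w B) = 8 * length ts + 6"
    and "fex_val (lookup_fex K ts m w B) x =
           B * sin (w * 2 powr (real m * horner 0 (map (ramp_bit K x) ts)))"
    and "\<forall>t\<in>set ts. fst t < d \<Longrightarrow> finite_expression d (lookup_fex K ts m w B)"
proof -
  show "fex_cost (lookup_fex K ts m w B) = 8 * length ts + 6"
    by (simp add: fex_cost_def lookup_fex_def Let_def)
  note R = run_address_code[of "[0]" 1, simplified]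
  show "fex_val (lookup_fex K ts m w B) x =
           B * sin (w * 2 powr (real m * horner 0 (map (ramp_bit K x) ts)))"
    using R(1)[of x K ts] R(2)[of x K ts]
    by (simp add: fex_val_def lookup_fex_def Let_def run_append nth_append)
  assume "\<forall>t\<in>set ts. fst t < d"
  thus "finite_expression d (lookup_fex K ts m w B)"
    using R(1)[of _ K ts] R(3)[of ts d _ K]
    by (auto simp: finite_expression_def lookup_fex_def Let_def run_ok_append)
qed

section \<open>One frequency stores a table of values\<close>

lemma abs_sin_diff_le: "\<bar>sin x - sin y\<bar> \<le> \<bar>x - (y::real)\<bar>"
proof -
  have "\<bar>sin x - sin y\<bar> \<le> 1 * \<bar>x - y\<bar>"
    using field_differentiable_bound[of UNIV sin cos 1 x y]
    by (auto intro!: derivative_eq_intros simp: dist_real_def)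
  thus ?thesis by simp
qed

text \<open>
  The number \<open>w\<close> is built like an expansion in base \<open>L\<close>, from the last entry of the table to the
  first. If \<open>w'\<close> serves the entries after the first, then \<open>(w' + 2 * pi * m) / L\<close> serves them
  after the shift by one place, for every integer \<open>m\<close>, since \<open>L ^ k\<close> is an integer. These
  candidates are spaced by \<open>2 * pi / L\<close>, so one of them lies that close to the arcsine of the first
  entry.
\<close>
lemma sin_interpolates:
  fixes L :: nat and y :: "nat \<Rightarrow> real"
  assumes "L > 0" "\<And>k. \<bar>y k\<bar> \<le> 1"
  shows "\<exists>w. \<forall>k<T. \<bar>sin (w * real L ^ k) - y k\<bar> \<le> 2 * pi / real L"
  using assms(2)
proof (induction T arbitrary: y)
  case 0
  show ?case by simp
next
  case (Suc T)
  obtain w' where w': "\<And>k. k < T \<Longrightarrow> \<bar>sin (w' * real L ^ k) - y (Suc k)\<bar> \<le> 2 * pi / real L"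
    using Suc.IH[of "\<lambda>k. y (Suc k)"] Suc.prems by blast
  define \<theta> where "\<theta> = arcsin (y 0)"
  (* rounding up leaves an error of at most one grid step *)
  define m where "m = \<lceil>(\<theta> * L - w') / (2 * pi)\<rceil>"
  define w where "w = (w' + 2 * pi * m) / L"
  have "\<bar>w - \<theta>\<bar> \<le> 2 * pi / L"
  proof -
    have "real_of_int m \<ge> (\<theta> * L - w') / (2 * pi)" "real_of_int m \<le> (\<theta> * L - w') / (2 * pi) + 1"
      unfolding m_def by linarith+
    hence "0 \<le> w' + 2 * pi * m - \<theta> * L" "w' + 2 * pi * m - \<theta> * L \<le> 2 * pi"
      by (simp_all add: field_simps)
    moreover have "w - \<theta> = (w' + 2 * pi * m - \<theta> * L) / L"
      using \<open>L > 0\<close> by (simp add: w_def field_simps)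
    ultimately show ?thesis
      using \<open>L > 0\<close> by (simp add: divide_right_mono)
  qed
  moreover have "sin \<theta> = y 0"
    using Suc.prems[of 0] by (simp add: \<theta>_def)
  ultimately have 0: "\<bar>sin w - y 0\<bar> \<le> 2 * pi / L"
    using abs_sin_diff_le[of w \<theta>] by simp
  have "sin (w * real L ^ Suc k) = sin (w' * real L ^ k)" for k
  proof -
    have "w * real L ^ Suc k = w' * real L ^ k + 2 * pi * of_int (m * int L ^ k)"
      using \<open>L > 0\<close> by (simp add: w_def field_simps)
    moreover have "sin (a + 2 * pi * of_int n) = sin a" for a n
      by (simp only: sin_add sin_int_2pin cos_int_2pin mult_1_right mult_zero_right add_0_right)
    ultimately show ?thesis
      by (simp only:)
  qed
  hence "\<bar>sin (w * real L ^ k) - y k\<bar> \<le> 2 * pi / real L" if "k < Suc T" for k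
    using that 0 w' by (cases k) auto
  thus ?case by blast
qed

section \<open>Threshold grids\<close>

lemma ramp_bounds: "c \<le> 0 \<Longrightarrow> ramp c = 0" "c \<ge> 1 \<Longrightarrow> ramp c = 1"
  by (auto simp: ramp_def)

text \<open>
  The interval from \<open>-1/2\<close> to \<open>1\<close> contains every side of the slab and has length \<open>3/2\<close>, so \<open>2 * N\<close>
  thresholds at distance \<open>1 / N\<close> are more than enough for every coordinate.
\<close>
definition grid_tests :: "nat \<Rightarrow> nat \<Rightarrow> (nat \<times> real) list" where
  "grid_tests d N = map (\<lambda>(i, j). (i, - 1/2 + real j / real N)) (List.product [0..<d] [0..<2 * N])"

lemma length_grid_tests: "length (grid_tests d N) = 2 * d * N"
  by (simp add: grid_tests_def)

lemma set_grid_tests: "set (grid_tests d N) = {(i, - 1/2 + real j / real N) | i j. i < d \<and> j < 2 * N}"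
  by (auto simp: grid_tests_def image_def)

text \<open>
  The points at which some ramp takes a value strictly between 0 and 1, so that the computed address
  is meaningless.
\<close>
definition undecided :: "real \<Rightarrow> (nat \<times> real) list \<Rightarrow> (nat \<Rightarrow> real) \<Rightarrow> bool" where
  "undecided K ts x \<longleftrightarrow> (\<exists>(i, a)\<in>set ts. 0 < (x i - a) * K \<and> (x i - a) * K < 1)"

definition threshold_bit :: "(nat \<Rightarrow> real) \<Rightarrow> nat \<times> real \<Rightarrow> nat" where
  "threshold_bit x t = of_bool (x (fst t) > snd t)"

lemma threshold_bit_range: "set (map (threshold_bit x) ts) \<subseteq> {0, 1}"
  by (auto simp: threshold_bit_def)

lemma ramp_bit_decided:
  assumes "\<not> undecided K ts x" "t \<in> set ts" "K > 0"
  shows "ramp_bit K x t = real (threshold_bit x t)"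
proof -
  have *: "(x (fst t) - snd t) * K \<le> 0 \<or> (x (fst t) - snd t) * K \<ge> 1"
    using assms by (force simp: undecided_def)
  show ?thesis
  proof (cases "x (fst t) > snd t")
    case True
    hence "(x (fst t) - snd t) * K > 0" using assms by simp
    with * True show ?thesis by (simp add: ramp_bit_def ramp_bounds threshold_bit_def)
  next
    case False
    hence "(x (fst t) - snd t) * K \<le> 0" using assms by (simp add: mult_nonpos_nonneg)
    with False show ?thesis by (simp add: ramp_bit_def ramp_bounds threshold_bit_def)
  qed
qed

text \<open>
  If two coordinates differ by more than one grid step, the first threshold above the smaller one
  separates them, and the corresponding bits differ.
\<close>
lemma same_bits_close:
  assumes "map (threshold_bit x) (grid_tests d N) = map (threshold_bit z) (grid_tests d N)"
    and "N > 0" "i < d" "-1/2 \<le> x i" "x i \<le> 1" "-1/2 \<le> z i" "z i \<le> 1"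
  shows "\<bar>x i - z i\<bar> \<le> 1 / real N"
proof -
  have eq: "threshold_bit x t = threshold_bit z t" if "t \<in> set (grid_tests d N)" for t
    using assms(1) that by (simp add: map_eq_conv)
  have "z i \<le> x i + 1 / real N" if eq: "\<And>t. t \<in> set (grid_tests d N) \<Longrightarrow> threshold_bit x t = threshold_bit z t"
    and "-1/2 \<le> x i" "z i \<le> 1" for x z :: "nat \<Rightarrow> real"
  proof (rule ccontr)
    assume far: "\<not> z i \<le> x i + 1 / real N"
    define j where "j = nat \<lceil>(x i + 1/2) * N\<rceil>"
    define a where "a = - 1/2 + real j / real N"
    have "(x i + 1/2) * N \<ge> 0" using that by simp
    hence j: "real j \<ge> (x i + 1/2) * N" "real j \<le> (x i + 1/2) * N + 1"
      unfolding j_def by linarith+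
    have "real j / N \<ge> x i + 1/2" "real j / N \<le> x i + 1/2 + 1 / N"
      using j \<open>N > 0\<close> by (simp_all add: field_simps)
    hence a: "x i \<le> a" "a < z i" using far by (auto simp: a_def)
    hence "real j / N < 3/2" using that unfolding a_def by linarith
    hence "real j < 2 * N" using \<open>N > 0\<close> by (simp add: field_simps)
    hence "(i, a) \<in> set (grid_tests d N)"
      using \<open>i < d\<close> unfolding set_grid_tests a_def by (auto simp flip: of_nat_less_iff)
    from eq[OF this] a show False by (simp add: threshold_bit_def)
  qed
  from this[of x z] this[of z x] eq assms show ?thesis by fastforce
qed

section \<open>Lebesgue measure of the slab and of the undecided points\<close>

lemma space_leb: "space (leb n) = Rn n"
  by (simp add: leb_def Rn_def space_PiM)

lemma sigma_finite_leb: "sigma_finite_measure (leb n)"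
proof -
  interpret finite_product_sigma_finite "\<lambda>_. lborel :: real measure" "{..<n}"
    by standard auto
  show ?thesis unfolding leb_def by (rule sigma_finite_measure_axioms)
qed

lemma measurable_coord_leb:
  "i < n \<Longrightarrow> (\<lambda>x. x i) \<in> borel_measurable (leb n)"
  unfolding leb_def using measurable_component_singleton[of i "{..<n}" "\<lambda>_. lborel :: real measure"]
  by simp

lemma emeasure_box:
  assumes "\<And>i. i < d \<Longrightarrow> A i \<in> sets borel"
  shows "(\<Pi>\<^sub>E i\<in>{..<d}. A i) \<in> sets (leb d)"
    "emeasure (leb d) (\<Pi>\<^sub>E i\<in>{..<d}. A i) = (\<Prod>i<d. emeasure lborel (A i))"
proof -
  interpret Q: product_sigma_finite "\<lambda>_. lborel :: real measure" by standard
  show "(\<Pi>\<^sub>E i\<in>{..<d}. A i) \<in> sets (leb d)"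
    unfolding leb_def using assms by (intro sets_PiM_I_finite) auto
  show "emeasure (leb d) (\<Pi>\<^sub>E i\<in>{..<d}. A i) = (\<Prod>i<d. emeasure lborel (A i))"
    unfolding leb_def using assms by (intro Q.emeasure_PiM) auto
qed

text \<open>
  Naming the sides gives the product a single family of factors, which keeps the case distinction on
  the last coordinate out of the measure computations.
\<close>
definition slab_side :: "nat \<Rightarrow> real \<Rightarrow> nat \<Rightarrow> real set" where
  "slab_side d \<kappa> i = (if i < d - 1 then {-1/2..1/2} else {\<kappa>..1})"

lemma slab_side:
  assumes "0 < \<kappa>" "\<kappa> < 1"
  shows "slab_side d \<kappa> i \<in> sets borel" "emeasure lborel (slab_side d \<kappa> i) \<le> 1"
    "slab_side d \<kappa> i \<subseteq> {-1/2..1}"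
  using assms by (auto simp: slab_side_def ennreal_le_1)

lemma slab_eq: "slab d \<kappa> = (\<Pi>\<^sub>E i\<in>{..<d}. slab_side d \<kappa> i)"
  by (simp add: slab_def slab_side_def)

lemma emeasure_slab:
  assumes "0 < \<kappa>" "\<kappa> < 1"
  shows "slab d \<kappa> \<in> sets (leb d)" "emeasure (leb d) (slab d \<kappa>) \<le> 1"
  using emeasure_box[of d "slab_side d \<kappa>"] slab_side[OF assms, of d]
  by (auto simp: slab_eq intro!: prod_le_1)

lemma emeasure_slab_strip:
  assumes "0 < \<kappa>" "\<kappa> < 1" "i < d" "K > 0"
  shows "{x \<in> slab d \<kappa>. 0 < (x i - a) * K \<and> (x i - a) * K < 1} \<in> sets (leb d)" (is "?S \<in> _")
    and "emeasure (leb d) {x \<in> slab d \<kappa>. 0 < (x i - a) * K \<and> (x i - a) * K < 1} \<le> ennreal (1 / K)"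
proof -
  define A where "A l = (if l = i then slab_side d \<kappa> l \<inter> {a<..<a + 1 / K} else slab_side d \<kappa> l)" for l
  have A: "A l \<in> sets borel" for l
    using slab_side[OF assms(1,2)] by (auto simp: A_def)
  have strip: "0 < (c - a) * K \<and> (c - a) * K < 1 \<longleftrightarrow> c \<in> {a<..<a + 1 / K}" for c
    using assms(4) by (simp add: field_simps zero_less_mult_iff)
  have "x \<in> ?S \<longleftrightarrow> x \<in> (\<Pi>\<^sub>E l\<in>{..<d}. A l)" for x
  proof -
    have "x \<in> ?S \<longleftrightarrow> x \<in> extensional {..<d} \<and> (\<forall>l<d. x l \<in> slab_side d \<kappa> l) \<and> x i \<in> {a<..<a + 1 / K}"
      unfolding strip slab_eq by (auto simp: PiE_iff)
    also have "\<dots> \<longleftrightarrow> x \<in> extensional {..<d} \<and> (\<forall>l<d. x l \<in> A l)"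
      using assms(3) unfolding A_def by (metis Int_iff)
    finally show ?thesis by (auto simp: PiE_iff)
  qed
  hence eq: "?S = (\<Pi>\<^sub>E l\<in>{..<d}. A l)" by blast
  show "?S \<in> sets (leb d)"
    unfolding eq using A by (intro emeasure_box)
  have "emeasure (leb d) ?S = (\<Prod>l<d. emeasure lborel (A l))"
    unfolding eq using A by (intro emeasure_box)
  also have "\<dots> \<le> (\<Prod>l<d. if l = i then ennreal (1 / K) else 1)"
  proof (intro prod_mono_ennreal)
    fix l
    have "emeasure lborel (slab_side d \<kappa> l \<inter> {a<..<a + 1 / K}) \<le> emeasure lborel {a<..<a + 1 / K}"
      by (intro emeasure_mono) auto
    thus "emeasure lborel (A l) \<le> (if l = i then ennreal (1 / K) else 1)"
      using assms slab_side[OF assms(1,2)] by (auto simp: A_def)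
  qed
  also have "\<dots> = ennreal (1 / K)"
    using assms by simp
  finally show "emeasure (leb d) ?S \<le> ennreal (1 / K)" .
qed

text \<open>
  Each test is undecided on a strip of width \<open>1 / K\<close>, and the other sides of the slab have length at
  most 1.
\<close>
lemma emeasure_undecided:
  assumes "0 < \<kappa>" "\<kappa> < 1" "K > 0" "\<forall>t\<in>set ts. fst t < d"
  shows "{x \<in> slab d \<kappa>. undecided K ts x} \<in> sets (leb d)"
    and "emeasure (leb d) {x \<in> slab d \<kappa>. undecided K ts x} \<le> ennreal (length ts / K)"
proof -
  define S where "S t = {x \<in> slab d \<kappa>. 0 < (x (fst t) - snd t) * K \<and> (x (fst t) - snd t) * K < 1}" for t
  have S: "S t \<in> sets (leb d)" "emeasure (leb d) (S t) \<le> ennreal (1 / K)" if "t \<in> set ts" for t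
    using emeasure_slab_strip[OF assms(1,2) _ assms(3)] assms(4) that by (auto simp: S_def)
  have eq: "{x \<in> slab d \<kappa>. undecided K ts x} = (\<Union>t\<in>set ts. S t)"
    by (auto simp: undecided_def S_def)
  show "{x \<in> slab d \<kappa>. undecided K ts x} \<in> sets (leb d)"
    unfolding eq using S by auto
  have "emeasure (leb d) (\<Union>t\<in>set ts. S t) \<le> (\<Sum>t\<in>set ts. emeasure (leb d) (S t))"
    using S by (intro emeasure_subadditive_finite) auto
  also have "\<dots> \<le> (\<Sum>t\<in>set ts. ennreal (1 / K))"
    using S by (intro sum_mono) auto
  also have "\<dots> = ennreal (card (set ts) / K)"
    using assms by (simp add: ennreal_of_nat_eq_real_of_nat ennreal_mult[symmetric])
  also have "\<dots> \<le> ennreal (length ts / K)"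
    using assms card_length[of ts] by (intro ennreal_leI divide_right_mono) auto
  finally show "emeasure (leb d) {x \<in> slab d \<kappa>. undecided K ts x} \<le> ennreal (length ts / K)"
    by (simp add: eq)
qed

lemma slab_memD:
  assumes "x \<in> slab d \<kappa>" "d \<ge> 1"
  shows "x \<in> Rn d" "\<kappa> \<le> x (d - 1)"
proof -
  have x: "x \<in> extensional {..<d}" "\<forall>i\<in>{..<d}. x i \<in> slab_side d \<kappa> i"
    using assms(1) unfolding slab_eq PiE_iff by blast+
  show "x \<in> Rn d" using x(1) unfolding Rn_def PiE_iff by blast
  have "x (d - 1) \<in> slab_side d \<kappa> (d - 1)" using x(2) assms(2) by simp
  thus "\<kappa> \<le> x (d - 1)" by (simp add: slab_side_def)
qed

section \<open>Approximation of slowly varying functions on the slab\<close>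

text \<open>
  The two contributions to the integral are each at most \<open>(\<epsilon> / 2) powr p\<close>, and
  \<open>2 * (1 / 2) powr p \<le> 1\<close> because \<open>p \<ge> 1\<close>.
\<close>
lemma Lp_norm_le_of_small_exceptional_set:
  assumes "1 \<le> p" "f \<in> borel_measurable M" "emeasure M (space M) \<le> 1" "E \<in> sets M"
    and "0 < \<epsilon>" "0 < b"
    and "\<And>x. x \<in> space M - E \<Longrightarrow> \<bar>f x\<bar> \<le> \<epsilon> / 2" "\<And>x. x \<in> space M \<Longrightarrow> \<bar>f x\<bar> \<le> b"
    and "emeasure M E \<le> ennreal ((\<epsilon> / 2) powr p / b powr p)"
  shows "in_Lp p M f" "Lp_norm p M f \<le> \<epsilon>"
proof -
  interpret finite_measure M
    using assms(3) by (intro finite_measureI) (auto simp: top_unique)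
  have m [measurable]: "f \<in> borel_measurable M" by fact
  have I: "integrable M (\<lambda>x. \<bar>f x\<bar> powr p)"
  proof (rule integrable_const_bound[of _ "b powr p"])
    show "AE x in M. norm (\<bar>f x\<bar> powr p) \<le> b powr p"
      using assms by (intro AE_I2) (auto intro!: powr_mono2)
  qed measurable
  have IE: "integrable M (indicator E :: _ \<Rightarrow> real)"
    using assms(4) by (rule integrable_real_indicator) (simp add: less_top[symmetric])
  show "in_Lp p M f" using I by (simp add: in_Lp_def)
  have "(LINT x|M. \<bar>f x\<bar> powr p) \<le> (LINT x|M. (\<epsilon> / 2) powr p + b powr p * indicator E x)"
  proof (rule integral_mono)
    fix x assume x: "x \<in> space M"
    show "\<bar>f x\<bar> powr p \<le> (\<epsilon> / 2) powr p + b powr p * indicator E x"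
    proof (cases "x \<in> E")
      case True
      have "\<bar>f x\<bar> powr p \<le> b powr p" using assms x by (intro powr_mono2) auto
      thus ?thesis using True by (simp add: add_increasing)
    next
      case False
      thus ?thesis using assms x by (auto intro!: powr_mono2)
    qed
  next
    show "integrable M (\<lambda>x. (\<epsilon> / 2) powr p + b powr p * indicator E x)"
      using IE by simp
  qed (use I in auto)
  also have "\<dots> = (\<epsilon> / 2) powr p * measure M (space M) + b powr p * measure M E"
    using IE assms(4) by simp
  also have "\<dots> \<le> (\<epsilon> / 2) powr p * 1 + b powr p * ((\<epsilon> / 2) powr p / b powr p)"
  proof (intro add_mono mult_left_mono)
    show "measure M (space M) \<le> 1"
      using assms(3) by (simp add: emeasure_eq_measure)
    show "measure M E \<le> (\<epsilon> / 2) powr p / b powr p"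
      using assms(9) by (simp add: emeasure_eq_measure)
  qed auto
  also have "\<dots> = 2 * (1 / 2) powr p * \<epsilon> powr p"
    using assms by (simp add: powr_divide)
  also have "\<dots> \<le> 1 * \<epsilon> powr p"
    using assms powr_mono'[of 1 p "1/2 :: real"] by (intro mult_right_mono) auto
  finally have "(LINT x|M. \<bar>f x\<bar> powr p) \<le> \<epsilon> powr p" by simp
  hence "(LINT x|M. \<bar>f x\<bar> powr p) powr (1 / p) \<le> (\<epsilon> powr p) powr (1 / p)"
    using assms by (intro powr_mono2 integral_nonneg) auto
  thus "Lp_norm p M f \<le> \<epsilon>"
    using assms by (simp add: Lp_norm_def powr_powr)
qed

lemma measurable_lookup_fex:
  assumes "\<forall>t\<in>set ts. fst t < d"
  shows "fex_val (lookup_fex K ts m w B) \<in> borel_measurable (leb d)"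
proof -
  have [measurable]: "(\<lambda>x. horner (c x) (map (ramp_bit K x) ts)) \<in> borel_measurable (leb d)"
    if "c \<in> borel_measurable (leb d)" for c :: "(nat \<Rightarrow> real) \<Rightarrow> real"
    using assms that
  proof (induction ts arbitrary: c)
    case (Cons t ts)
    have [measurable]: "(\<lambda>x. x (fst t)) \<in> borel_measurable (leb d)"
      using Cons.prems by (intro measurable_coord_leb) auto
    have [measurable]: "c \<in> borel_measurable (leb d)" by fact
    have "(\<lambda>x. c x + c x + ramp_bit K x t) \<in> borel_measurable (leb d)"
      unfolding ramp_bit_def ramp_def by measurable
    from Cons.IH[OF _ this] Cons.prems show ?case by simp
  qed simp
  show ?thesis
    unfolding lookup_fex(2)[abs_def] by measurable
qed

text \<open>
  Each address that occurs gets a representative point, and the table stores the value of \<open>u\<close> there.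
  Points with the same address are close, so one \<open>\<eta>\<close> pays for replacing a point by its
  representative and the other for the imprecision of the table. The table is fixed before the
  slope \<open>K\<close>, which can therefore be taken as large as desired.
\<close>
lemma lookup_table_exists:
  fixes u :: "(nat \<Rightarrow> real) \<Rightarrow> real"
  assumes "B > 0" "\<eta> > 0" "N > 0" "D \<subseteq> {x. \<forall>i<d. -1/2 \<le> x i \<and> x i \<le> 1}"
    and "\<And>x. x \<in> D \<Longrightarrow> \<bar>u x\<bar> \<le> B"
    and "\<And>x z. x \<in> D \<Longrightarrow> z \<in> D \<Longrightarrow> (\<And>i. i < d \<Longrightarrow> \<bar>x i - z i\<bar> \<le> 1 / real N) \<Longrightarrow> \<bar>u x - u z\<bar> \<le> \<eta>"
  shows "\<exists>m w. \<forall>K>0. \<forall>x\<in>D. \<not> undecided K (grid_tests d N) x \<longrightarrow>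
           \<bar>u x - fex_val (lookup_fex K (grid_tests d N) m w B) x\<bar> \<le> 2 * \<eta>"
proof -
  let ?ts = "grid_tests d N"
  define address where "address x = horner 0 (map (threshold_bit x) ?ts)" for x
  (* for an address that does not occur, c k is an arbitrary point and u (c k) need not be bounded *)
  define c where "c k = (SOME z. z \<in> D \<and> address z = k)" for k
  have c: "c (address x) \<in> D" "address (c (address x)) = address x" if "x \<in> D" for x
    using someI[of "\<lambda>z. z \<in> D \<and> address z = address x" x] that by (auto simp: c_def)
  have close: "\<bar>u x - u (c (address x))\<bar> \<le> \<eta>" if x: "x \<in> D" for x
  proof (rule assms(6)[OF x c(1)[OF x]])
    fix i assume i: "i < d"
    have "map (threshold_bit x) ?ts = map (threshold_bit (c (address x))) ?ts"
      using c(2)[OF x] unfolding address_def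
      by (intro horner_inj[THEN conjunct1, of _ _ 0 0] threshold_bit_range) auto
    thus "\<bar>x i - c (address x) i\<bar> \<le> 1 / real N"
      using assms(3,4) i x c(1)[OF x] by (intro same_bits_close) auto
  qed
  obtain m where m: "2 * pi * B / \<eta> < 2 ^ m"
    using real_arch_pow[of 2 "2 * pi * B / \<eta>"] by auto
  (* the case distinction keeps the entries of unused addresses inside the range of the sine *)
  define y where "y k = (if \<bar>u (c k)\<bar> \<le> B then u (c k) / B else 0)" for k
  have "\<bar>y k\<bar> \<le> 1" for k
    using assms(1) by (simp add: y_def abs_divide)
  then obtain w where w: "\<And>k. k < 2 ^ length ?ts \<Longrightarrow> \<bar>sin (w * real (2 ^ m) ^ k) - y k\<bar> \<le> 2 * pi / real (2 ^ m)"
    using sin_interpolates[of "2 ^ m" y "2 ^ length ?ts"] by auto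
  show ?thesis
  proof (intro exI allI ballI impI)
    fix K :: real and x
    assume K: "K > 0" and x: "x \<in> D" and dec: "\<not> undecided K ?ts x"
    define k where "k = address x"
    have "map (ramp_bit K x) ?ts = map real (map (threshold_bit x) ?ts)"
      using ramp_bit_decided[OF dec _ K] by simp
    hence "horner 0 (map (ramp_bit K x) ?ts) = horner (of_nat 0) (map real (map (threshold_bit x) ?ts))"
      by (simp only: of_nat_0)
    also have "\<dots> = real k"
      unfolding horner_of_nat k_def address_def ..
    finally have idx: "horner 0 (map (ramp_bit K x) ?ts) = real k" .
    have val: "fex_val (lookup_fex K ?ts m w B) x = B * sin (w * real (2 ^ m) ^ k)"
      by (simp add: lookup_fex(2) idx powr_realpow[symmetric] powr_powr[symmetric])
    have "k < 2 ^ length ?ts"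
      using horner_less[OF threshold_bit_range, of 0 x ?ts] by (simp add: k_def address_def)
    hence "B * \<bar>sin (w * real (2 ^ m) ^ k) - y k\<bar> \<le> B * (2 * pi / real (2 ^ m))"
      using w assms(1) by (intro mult_left_mono) auto
    also have "\<dots> \<le> \<eta>"
      using m assms(2) by (simp add: field_simps)
    finally have "\<bar>B * sin (w * real (2 ^ m) ^ k) - B * y k\<bar> \<le> \<eta>"
      using assms(1) by (simp add: right_diff_distrib[symmetric] abs_mult)
    moreover have "B * y k = u (c k)"
      using assms(1,5) c(1)[OF x] by (simp add: y_def k_def)
    ultimately show "\<bar>u x - fex_val (lookup_fex K ?ts m w B) x\<bar> \<le> 2 * \<eta>"
      using close[OF x] unfolding val k_def by linarith
  qed
qed

text \<open>
  The value of the program is bounded by \<open>B\<close> everywhere because it ends with a sine, so the error on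
  the undecided points is at most \<open>2 * B\<close>, and a large slope makes their contribution to the
  integral negligible. Only the number of thresholds enters the cost; the sizes of the constants do
  not.
\<close>
lemma Lp_approximation_on_slab:
  assumes "1 \<le> p" "0 < \<kappa>" "\<kappa> < 1" "0 < \<epsilon>" "0 < B" "0 < N"
    and "u \<in> borel_measurable (leb d)"
    and "\<And>x. x \<in> slab d \<kappa> \<Longrightarrow> \<bar>u x\<bar> \<le> B"
    and "\<And>x z. x \<in> slab d \<kappa> \<Longrightarrow> z \<in> slab d \<kappa> \<Longrightarrow> (\<And>i. i < d \<Longrightarrow> \<bar>x i - z i\<bar> \<le> 1 / real N) \<Longrightarrow>
               \<bar>u x - u z\<bar> \<le> \<epsilon> / 4"
  shows "\<exists>\<Psi>. finite_expression d \<Psi> \<and> Lp_approximates p d (slab d \<kappa>) u \<epsilon> \<Psi> \<and>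
             fex_cost \<Psi> = 16 * d * N + 6"
proof -
  let ?ts = "grid_tests d N"
  let ?M = "restrict_space (leb d) (slab d \<kappa>)"
  have fst: "\<forall>t\<in>set ?ts. fst t < d" by (auto simp: set_grid_tests)
  have sl: "slab d \<kappa> \<in> sets (leb d)" "emeasure (leb d) (slab d \<kappa>) \<le> 1"
    using emeasure_slab[OF assms(2,3)] by auto
  have sp: "space ?M = slab d \<kappa>"
    using sets.sets_into_space[OF sl(1)] by (auto simp: space_restrict_space)
  have box: "slab d \<kappa> \<subseteq> {x. \<forall>i<d. -1/2 \<le> x i \<and> x i \<le> 1}"
  proof clarify
    fix x i assume x: "x \<in> slab d \<kappa>" and i: "i < d"
    have "x i \<in> slab_side d \<kappa> i"
      using x i unfolding slab_eq by (intro PiE_mem[of x]) auto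
    with slab_side(3)[OF assms(2,3)] show "-1/2 \<le> x i \<and> x i \<le> 1" by fastforce
  qed
  have "\<exists>m w. \<forall>K>0. \<forall>x\<in>slab d \<kappa>. \<not> undecided K ?ts x \<longrightarrow>
      \<bar>u x - fex_val (lookup_fex K ?ts m w B) x\<bar> \<le> 2 * (\<epsilon> / 4)"
    using assms(4) by (intro lookup_table_exists assms(5,6,8,9) box) simp_all
  then obtain m w where mw: "\<forall>K>0. \<forall>x\<in>slab d \<kappa>. \<not> undecided K ?ts x \<longrightarrow>
      \<bar>u x - fex_val (lookup_fex K ?ts m w B) x\<bar> \<le> 2 * (\<epsilon> / 4)"
    by (elim exE)
  define q where "q = (\<epsilon> / 2) powr p / (2 * B) powr p"
  have q: "q > 0" using assms(4,5) by (simp add: q_def)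
  (* the summand 1 keeps K positive when there are no tests *)
  define K where "K = (length ?ts + 1) / q"
  have K: "K > 0" using q by (simp add: K_def)
  define \<Psi> where "\<Psi> = lookup_fex K ?ts m w B"
  define E where "E = {x \<in> slab d \<kappa>. undecided K ?ts x}"
  have E: "E \<in> sets (leb d)" "emeasure (leb d) E \<le> ennreal (length ?ts / K)"
    using emeasure_undecided[OF assms(2,3) K fst] by (auto simp: E_def)
  have "length ?ts / K \<le> q"
    using q by (simp add: K_def field_simps)
  hence Eq: "emeasure (leb d) E \<le> ennreal q"
    using E(2) by (meson ennreal_leI order_trans)
  let ?f = "\<lambda>x. u x - fex_val \<Psi> x"
  have f: "?f \<in> borel_measurable ?M"
    using assms(7) measurable_lookup_fex[OF fst] unfolding \<Psi>_def
    by (intro measurable_restrict_space1 borel_measurable_diff) auto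
  have M: "emeasure ?M (space ?M) \<le> 1"
    unfolding sp using sl by (subst emeasure_restrict_space) auto
  have EM: "E \<in> sets ?M"
    using sl E by (auto simp: sets_restrict_space_iff E_def)
  have E_small: "emeasure ?M E \<le> ennreal ((\<epsilon> / 2) powr p / (2 * B) powr p)"
    using sl Eq by (subst emeasure_restrict_space) (auto simp: E_def q_def)
  have off_E: "\<bar>?f x\<bar> \<le> \<epsilon> / 2" if "x \<in> space ?M - E" for x
    using mw[rule_format, OF K, of x] that by (simp add: sp E_def \<Psi>_def)
  have bound: "\<bar>?f x\<bar> \<le> 2 * B" if "x \<in> space ?M" for x
  proof -
    have "\<bar>fex_val \<Psi> x\<bar> \<le> B * 1"
      unfolding \<Psi>_def lookup_fex(2) abs_mult using assms(5) by (intro mult_mono) auto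
    thus ?thesis using assms(8)[of x] that by (simp add: sp)
  qed
  have "0 < 2 * B" using assms(5) by simp
  note Lp = Lp_norm_le_of_small_exceptional_set[OF assms(1) f M EM assms(4) this off_E bound E_small]
  from Lp have "Lp_approximates p d (slab d \<kappa>) u \<epsilon> \<Psi>"
    by (simp add: Lp_approximates_def)
  moreover have "finite_expression d \<Psi>"
    unfolding \<Psi>_def by (rule lookup_fex(3)[OF fst])
  moreover have "fex_cost \<Psi> = 16 * d * N + 6"
    by (simp add: \<Psi>_def lookup_fex(1) length_grid_tests)
  ultimately show ?thesis by blast
qed

section \<open>Total mass of the Poisson kernel\<close>

lemma ndist_sq: "(ndist n x y)\<^sup>2 = (\<Sum>i<n. (x i - y i)\<^sup>2)"
  by (simp add: ndist_def L2_set_def sum_nonneg)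

text \<open>
  As in the definition of the Poisson extension, \<open>x\<close> carries both the horizontal part and, in
  coordinate \<open>d - 1\<close>, the height.
\<close>
definition poisson_kernel :: "nat \<Rightarrow> (nat \<Rightarrow> real) \<Rightarrow> (nat \<Rightarrow> real) \<Rightarrow> real" where
  "poisson_kernel d x y = Gamma (real d / 2) / pi powr (real d / 2) *
     (x (d - 1) / ((ndist (d - 1) x y)\<^sup>2 + (x (d - 1))\<^sup>2) powr (real d / 2))"

lemma measurable_poisson_kernel:
  assumes "d \<ge> 1"
  shows "(\<lambda>(x, y). poisson_kernel d x y) \<in> borel_measurable (leb d \<Otimes>\<^sub>M leb (d - 1))"
proof -
  have 1: "(\<lambda>p. fst p i) \<in> borel_measurable (leb d \<Otimes>\<^sub>M leb (d - 1))" if "i < d" for i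
    using measurable_compose[OF measurable_fst measurable_coord_leb[OF that]] .
  have 2: "(\<lambda>p. snd p i) \<in> borel_measurable (leb d \<Otimes>\<^sub>M leb (d - 1))" if "i < d - 1" for i
    using measurable_compose[OF measurable_snd measurable_coord_leb[OF that]] .
  have [measurable]: "(\<lambda>p. (\<Sum>i<d-1. (fst p i - snd p i)\<^sup>2)) \<in> borel_measurable (leb d \<Otimes>\<^sub>M leb (d - 1))"
    by (intro borel_measurable_sum borel_measurable_power borel_measurable_diff 1 2) auto
  have [measurable]: "(\<lambda>p. fst p (d - 1)) \<in> borel_measurable (leb d \<Otimes>\<^sub>M leb (d - 1))"
    using assms by (intro 1) auto
  show ?thesis
    unfolding poisson_kernel_def ndist_sq case_prod_beta' by measurable
qed

lemma nn_integral_Gamma_scaled: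
  assumes "b > 0" "a > (0::real)"
  shows "(\<integral>\<^sup>+s. ennreal (indicator {0<..} s * (s powr (b - 1) * exp (- (s * a)))) \<partial>lborel) =
           ennreal (Gamma b / a powr b)"
proof -
  let ?f = "\<lambda>t::real. ennreal (indicator {0..} t * t powr (b - 1) / exp t)"
  have "ennreal (Gamma b) = (\<integral>\<^sup>+t. ?f t \<partial>lborel)"
    using Gamma_conv_nn_integral_real[OF assms(1)] by simp
  also have "\<dots> = \<bar>a\<bar> * (\<integral>\<^sup>+s. ?f (0 + a * s) \<partial>lborel)"
    using assms by (intro nn_integral_real_affine) auto
  also have "\<dots> = (\<integral>\<^sup>+s. ennreal a * ?f (0 + a * s) \<partial>lborel)"
    using assms by (subst nn_integral_cmult) auto
  also have "\<dots> = (\<integral>\<^sup>+s. ennreal (a powr b) *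
      ennreal (indicator {0<..} s * (s powr (b - 1) * exp (- (s * a)))) \<partial>lborel)"
  proof (intro nn_integral_cong)
    fix s :: real
    have "a * (indicator {0..} (a * s) * (a * s) powr (b - 1) / exp (a * s)) =
          a powr b * (indicator {0<..} s * (s powr (b - 1) * exp (- (s * a))))"
    proof (cases "s > 0")
      case True
      have "a * a powr (b - 1) = a powr b"
        using assms by (simp add: powr_diff)
      then show ?thesis
        using True assms by (simp add: powr_mult exp_minus field_simps)
    next
      case False
      then show ?thesis
        using assms by (cases "s = 0") (auto simp: indicator_def mult_nonneg_nonpos zero_le_mult_iff)
    qed
    thus "ennreal a * ?f (0 + a * s) = ennreal (a powr b) *
      ennreal (indicator {0<..} s * (s powr (b - 1) * exp (- (s * a))))"
      using assms by (simp add: ennreal_mult'[symmetric])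
  qed
  also have "\<dots> = ennreal (a powr b) *
      (\<integral>\<^sup>+s. ennreal (indicator {0<..} s * (s powr (b - 1) * exp (- (s * a)))) \<partial>lborel)"
    by (intro nn_integral_cmult) auto
  finally have *: "ennreal (Gamma b) = ennreal (a powr b) *
      (\<integral>\<^sup>+s. ennreal (indicator {0<..} s * (s powr (b - 1) * exp (- (s * a)))) \<partial>lborel)"
      (is "_ = _ * ?I") .
  have "?I = ennreal (1 / a powr b) * (ennreal (a powr b) * ?I)"
    using assms by (simp add: mult.assoc[symmetric] ennreal_mult'[symmetric])
  also have "\<dots> = ennreal (Gamma b / a powr b)"
    using assms by (simp add: *[symmetric] ennreal_mult'[symmetric])
  finally show ?thesis .
qed

lemma nn_integral_gaussian:
  assumes "s > 0"
  shows "(\<integral>\<^sup>+y. ennreal (exp (- (s * (m - y)\<^sup>2))) \<partial>lborel) = ennreal (sqrt (pi / s))"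
proof -
  define \<sigma> where "\<sigma> = sqrt (1 / (2 * s))"
  have \<sigma>: "\<sigma> > 0" "\<sigma>\<^sup>2 = 1 / (2 * s)" using assms by (auto simp: \<sigma>_def)
  have eq: "exp (- (s * (m - y)\<^sup>2)) = sqrt (pi / s) * normal_density m \<sigma> y" for y
    using assms by (simp add: normal_density_def \<sigma> real_sqrt_divide power2_commute)
  have "(\<integral>\<^sup>+y. ennreal (exp (- (s * (m - y)\<^sup>2))) \<partial>lborel) =
      ennreal (sqrt (pi / s)) * (\<integral>\<^sup>+y. ennreal (normal_density m \<sigma> y) \<partial>lborel)"
    using assms unfolding eq by (subst nn_integral_cmult[symmetric]) (auto simp: ennreal_mult')
  also have "(\<integral>\<^sup>+y. ennreal (normal_density m \<sigma> y) \<partial>lborel) = 1"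
    using \<sigma> by (subst nn_integral_eq_integral) auto
  finally show ?thesis by simp
qed

text \<open>
  The Gamma integral writes the power \<open>a powr - (d / 2)\<close> as a mixture of the exponentials
  \<open>exp (- (s * a))\<close>, which turns the kernel into a mixture of Gaussians in \<open>y\<close>. After exchanging the
  integrals, the Gaussian integral factorises over the coordinates, and the integral over \<open>s\<close> that
  remains is again a Gamma integral, with parameter \<open>1/2\<close>.
\<close>
lemma nn_integral_poisson_kernel:
  assumes "d \<ge> 1" "x (d - 1) > 0"
  shows "(\<integral>\<^sup>+y. ennreal (poisson_kernel d x y) \<partial>leb (d - 1)) = 1"
proof -
  define n t b where "n = d - 1" and "t = x (d - 1)" and "b = real d / 2"
  have b: "b > 0" and t: "t > 0" using assms by (auto simp: b_def t_def)
  define c where "c = t / pi powr b"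
  have c: "c > 0" using t by (simp add: c_def)
  (* the integrand of the Gaussian mixture, without the constant c *)
  define F where "F s y = ennreal (indicator {0<..} s * (s powr (b - 1) * exp (- (s * ((ndist n x y)\<^sup>2 + t\<^sup>2)))))" for s y
  interpret L: sigma_finite_measure "leb n" by (rule sigma_finite_leb)
  interpret P: pair_sigma_finite "lborel :: real measure" "leb n" by standard
  have [measurable]: "(\<lambda>y. (ndist n x y)\<^sup>2) \<in> borel_measurable (leb n)"
    unfolding ndist_sq
    by (intro borel_measurable_sum borel_measurable_power borel_measurable_diff measurable_coord_leb) auto
  have Fm: "(\<lambda>(s, y). F s y) \<in> borel_measurable (lborel \<Otimes>\<^sub>M leb n)"
    unfolding F_def case_prod_beta' by measurable
  have Fm': "(\<lambda>(y, s). F s y) \<in> borel_measurable (leb n \<Otimes>\<^sub>M lborel)"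
    unfolding F_def case_prod_beta' by measurable
  have k: "ennreal (poisson_kernel d x y) = ennreal c * (\<integral>\<^sup>+s. F s y \<partial>lborel)" for y
  proof -
    have "(\<integral>\<^sup>+s. F s y \<partial>lborel) = ennreal (Gamma b / ((ndist n x y)\<^sup>2 + t\<^sup>2) powr b)"
      unfolding F_def using t b by (intro nn_integral_Gamma_scaled add_nonneg_pos) auto
    thus ?thesis
      using c by (simp add: poisson_kernel_def c_def ennreal_mult'[symmetric] b_def n_def t_def mult_ac)
  qed
  have G: "(\<integral>\<^sup>+y. F s y \<partial>leb n) =
      ennreal (pi powr (real n / 2)) * ennreal (indicator {0<..} s * (s powr (1/2 - 1) * exp (- (s * t\<^sup>2))))" for s
  proof (cases "s > 0")
    case True
    interpret Q: product_sigma_finite "\<lambda>_. lborel :: real measure" by standard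
    have "(\<integral>\<^sup>+y. (\<Prod>i<n. ennreal (exp (- (s * (x i - y i)\<^sup>2)))) \<partial>leb n) =
        (\<Prod>i<n. (\<integral>\<^sup>+y. ennreal (exp (- (s * (x i - y)\<^sup>2))) \<partial>lborel))"
      unfolding leb_def by (intro Q.product_nn_integral_prod) auto
    also have "\<dots> = ennreal (sqrt (pi / s) ^ n)"
      using True by (simp add: nn_integral_gaussian ennreal_power)
    also have "sqrt (pi / s) ^ n = (pi / s) powr (real n / 2)"
      using True by (simp add: powr_half_sqrt[symmetric] powr_realpow[symmetric] powr_powr)
    finally have I: "(\<integral>\<^sup>+y. (\<Prod>i<n. ennreal (exp (- (s * (x i - y i)\<^sup>2)))) \<partial>leb n) =
        ennreal ((pi / s) powr (real n / 2))" .
    have F: "F s y = ennreal (s powr (b - 1) * exp (- (s * t\<^sup>2))) *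
        (\<Prod>i<n. ennreal (exp (- (s * (x i - y i)\<^sup>2))))" for y
      using True
      by (simp add: F_def ndist_sq prod_ennreal exp_sum[symmetric] ennreal_mult'[symmetric] sum_negf
          sum_distrib_left[symmetric] distrib_left exp_add[symmetric] mult.assoc exp_diff[symmetric])
    have "(\<integral>\<^sup>+y. F s y \<partial>leb n) = ennreal (s powr (b - 1) * exp (- (s * t\<^sup>2))) *
        ennreal ((pi / s) powr (real n / 2))"
      unfolding F I[symmetric]
    proof (intro nn_integral_cmult borel_measurable_prod_ennreal)
      fix i assume "i \<in> {..<n}"
      hence [measurable]: "(\<lambda>y. y i) \<in> borel_measurable (leb n)"
        by (intro measurable_coord_leb) auto
      show "(\<lambda>y. ennreal (exp (- (s * (x i - y i)\<^sup>2)))) \<in> borel_measurable (leb n)"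
        by measurable
    qed
    also have "\<dots> = ennreal (s powr (b - 1) * exp (- (s * t\<^sup>2)) * (pi / s) powr (real n / 2))"
      by (simp add: ennreal_mult'[symmetric])
    also have "s powr (b - 1) * exp (- (s * t\<^sup>2)) * (pi / s) powr (real n / 2) =
        pi powr (real n / 2) * (s powr (b - 1 - real n / 2) * exp (- (s * t\<^sup>2)))"
      using True by (simp add: powr_divide powr_diff)
    also have "b - 1 - real n / 2 = 1/2 - 1"
      using assms by (simp add: b_def n_def field_simps)
    finally show ?thesis
      using True by (simp add: ennreal_mult')
  qed (simp add: F_def)
  have "(\<integral>\<^sup>+y. ennreal (poisson_kernel d x y) \<partial>leb n) =
      ennreal c * (\<integral>\<^sup>+y. (\<integral>\<^sup>+s. F s y \<partial>lborel) \<partial>leb n)"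
    unfolding k using lborel.borel_measurable_nn_integral[OF Fm']
    by (intro nn_integral_cmult) auto
  also have "(\<integral>\<^sup>+y. (\<integral>\<^sup>+s. F s y \<partial>lborel) \<partial>leb n) = (\<integral>\<^sup>+s. (\<integral>\<^sup>+y. F s y \<partial>leb n) \<partial>lborel)"
    by (rule P.Fubini'[OF Fm])
  also have "\<dots> = ennreal (pi powr (real n / 2)) * ennreal (Gamma (1/2) / (t\<^sup>2) powr (1/2))"
    unfolding G using t nn_integral_Gamma_scaled[of "1/2" "t\<^sup>2"]
    by (subst nn_integral_cmult) simp_all
  also have "ennreal c * \<dots> = ennreal (c * (pi powr (real n / 2) * (sqrt pi / t)))"
    using c t by (simp add: ennreal_mult'[symmetric] Gamma_one_half_real powr_half_sqrt)
  also have "c * (pi powr (real n / 2) * (sqrt pi / t)) = pi powr (real n / 2) * pi powr (1/2) / pi powr b"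
    using t by (simp add: c_def powr_half_sqrt)
  also have "\<dots> = 1"
    using assms by (simp add: powr_add[symmetric] b_def n_def field_simps)
  finally show ?thesis by (simp add: n_def)
qed

section \<open>Harnack inequality and modulus of the Poisson extension\<close>

lemma integrable_poisson_kernel:
  assumes "d \<ge> 1" "x \<in> Rn d" "x (d - 1) > 0"
  shows "integrable (leb (d - 1)) (poisson_kernel d x)" "(LINT y|leb (d - 1). poisson_kernel d x y) = 1"
proof -
  have m: "poisson_kernel d x \<in> borel_measurable (leb (d - 1))"
    using measurable_Pair2[OF measurable_poisson_kernel, of d x] assms
    by (simp add: space_leb)
  have nn: "poisson_kernel d x y \<ge> 0" for y
    using assms by (simp add: poisson_kernel_def)
  note I = nn_integral_poisson_kernel[of d x, OF assms(1,3)]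
  show "integrable (leb (d - 1)) (poisson_kernel d x)"
    using m nn I by (intro integrableI_nonneg) auto
  show "(LINT y|leb (d - 1). poisson_kernel d x y) = 1"
    using m nn I by (subst integral_eq_nn_integral) auto
qed

text \<open>
  The product sigma-algebra over all natural numbers is the Borel algebra of the product topology;
  a point of \<open>Rn n\<close> is constant outside the first \<open>n\<close> coordinates, so the inclusion of \<open>leb n\<close>
  into this space is measurable.
\<close>
lemma measurable_continuous_on_Rn:
  assumes "continuous_on (Rn n) (g :: (nat \<Rightarrow> real) \<Rightarrow> real)"
  shows "g \<in> borel_measurable (leb n)"
proof -
  have "(\<lambda>x. x) \<in> measurable (leb n) (PiM UNIV (\<lambda>_. borel))"
  proof (rule measurable_PiM_single')
    fix i :: nat
    show "(\<lambda>x. x i) \<in> borel_measurable (leb n)"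
    proof (cases "i < n")
      case False
      have "(\<lambda>x. x i) \<in> borel_measurable (leb n) \<longleftrightarrow> (\<lambda>x. undefined :: real) \<in> borel_measurable (leb n)"
        using False by (intro measurable_cong) (auto simp: space_leb Rn_def PiE_def extensional_def)
      thus ?thesis by simp
    qed (rule measurable_coord_leb)
  qed auto
  hence "(\<lambda>x. x) \<in> measurable (leb n) borel"
    using measurable_cong_sets[OF refl sets_PiM_equal_borel] by blast
  hence "(\<lambda>x. x) \<in> measurable (leb n) (restrict_space borel (Rn n))"
    by (intro measurable_restrict_space2) (auto simp: space_leb)
  from measurable_compose[OF this borel_measurable_continuous_on_restrict[OF assms]]
  show ?thesis by simp
qed

lemma poisson_extension_eq:
  "poisson_extension d g x = (LINT y|leb (d - 1). g y * poisson_kernel d x y)"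
  by (simp add: poisson_extension_def poisson_kernel_def mult.assoc)

lemma measurable_poisson_extension:
  assumes "d \<ge> 1" "continuous_on (Rn (d - 1)) g"
  shows "poisson_extension d g \<in> borel_measurable (leb d)"
proof -
  interpret L: sigma_finite_measure "leb (d - 1)" by (rule sigma_finite_leb)
  note [measurable] = measurable_poisson_kernel[OF assms(1)] measurable_continuous_on_Rn[OF assms(2)]
  show ?thesis
    unfolding poisson_extension_eq[abs_def]
    by (rule L.borel_measurable_lebesgue_integral) measurable
qed

text \<open>
  The kernel is the height divided by the \<open>d\<close>-th power of the distance between \<open>x\<close> and the boundary
  point \<open>(y, 0)\<close>. Both quantities are at least \<open>\<kappa>\<close> and change by at most \<open>h\<close> and \<open>d * h\<close>, so they
  change by factors of at most \<open>exp (h / \<kappa>)\<close> and \<open>exp (d * h / \<kappa>)\<close>. The exponent is uniform in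
  \<open>y\<close> and polynomial in \<open>d\<close>.
\<close>
lemma poisson_kernel_Harnack:
  assumes "d \<ge> 1" "0 < \<kappa>" "\<kappa> \<le> 1" "\<kappa> \<le> x (d - 1)" "\<kappa> \<le> z (d - 1)" "h \<ge> 0"
    and "\<And>i. i < d \<Longrightarrow> \<bar>x i - z i\<bar> \<le> h"
  shows "poisson_kernel d z y \<le> exp (2 * (real d)\<^sup>2 * h / \<kappa>) * poisson_kernel d x y"
proof -
  define n where "n = d - 1"
  have d: "d = Suc n" using assms by (simp add: n_def)
  (* the vector from (y, 0) to x, of Euclidean length A x *)
  define v where "v x i = (if i < n then x i - y i else x i)" for x :: "nat \<Rightarrow> real" and i
  define A where "A x = L2_set (v x) {..<d}" for x
  have A: "(ndist n x y)\<^sup>2 + (x n)\<^sup>2 = (A x)\<^sup>2" for x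
    by (simp add: A_def L2_set_def sum_nonneg add_nonneg_nonneg ndist_def d v_def)
  have A_ge: "A x \<ge> x n" for x
    using member_le_L2_set[of "{..<d}" n "v x"] by (simp add: A_def d v_def)
  have pos: "A x > 0" "A z > 0" "x n > 0" "z n > 0"
    using A_ge[of x] A_ge[of z] assms by (auto simp: n_def)
  have "A x \<le> A z + d * h"
  proof -
    have "A x = L2_set (\<lambda>i. v z i + (x i - z i)) {..<d}"
      unfolding A_def by (intro L2_set_cong) (auto simp: v_def)
    also have "\<dots> \<le> A z + L2_set (\<lambda>i. x i - z i) {..<d}"
      unfolding A_def by (rule L2_set_triangle_ineq)
    also have "L2_set (\<lambda>i. x i - z i) {..<d} \<le> (\<Sum>i<d. \<bar>x i - z i\<bar>)"
      by (rule L2_set_le_sum_abs)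
    also have "\<dots> \<le> (\<Sum>i<d. h)" using assms by (intro sum_mono) auto
    finally show ?thesis by simp
  qed
  also have "\<dots> \<le> A z + (A z / \<kappa>) * (d * h)"
  proof -
    have "1 \<le> A z / \<kappa>" using assms A_ge[of z] by (simp add: n_def)
    from mult_right_mono[OF this, of "d * h"] show ?thesis using assms by simp
  qed
  also have "\<dots> = A z * (1 + d * h / \<kappa>)"
    by (simp add: algebra_simps)
  also have "\<dots> \<le> A z * exp (d * h / \<kappa>)"
    using pos by (intro mult_left_mono) auto
  finally have 1: "A x \<le> A z * exp (d * h / \<kappa>)" .
  have "z n \<le> x n + h"
    using assms(7)[of n] by (simp add: d abs_le_iff)
  also have "\<dots> \<le> x n + x n / \<kappa> * h"
  proof -
    have "1 \<le> x n / \<kappa>" using assms by (simp add: n_def)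
    from mult_right_mono[OF this, of h] show ?thesis using assms by simp
  qed
  also have "\<dots> = x n * (1 + h / \<kappa>)" by (simp add: algebra_simps)
  also have "\<dots> \<le> x n * exp (h / \<kappa>)"
    using pos by (intro mult_left_mono) auto
  finally have 2: "z n \<le> x n * exp (h / \<kappa>)" .
  have P: "((A x)\<^sup>2) powr (real d / 2) = A x ^ d" if "A x > 0" for x
    using that by (simp add: powr_powr powr_realpow[symmetric] del: powr_realpow flip: powr_numeral)
  have "z n / A z ^ d \<le> x n * exp (h / \<kappa>) / (A x / exp (d * h / \<kappa>)) ^ d"
    using pos 1 2 by (intro frac_le power_mono) (auto simp: field_simps)
  also have "\<dots> = exp (h / \<kappa> + d * (d * h / \<kappa>)) * (x n / A x ^ d)"
    by (simp add: power_divide exp_add exp_of_nat_mult[symmetric])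
  also have "\<dots> \<le> exp (2 * (real d)\<^sup>2 * h / \<kappa>) * (x n / A x ^ d)"
  proof (intro mult_right_mono)
    have "1 * h \<le> (real d)\<^sup>2 * h"
      using assms by (intro mult_right_mono) (auto simp: one_le_power)
    thus "exp (h / \<kappa> + d * (d * h / \<kappa>)) \<le> exp (2 * (real d)\<^sup>2 * h / \<kappa>)"
      using assms by (simp add: field_simps power2_eq_square)
  qed (use pos in auto)
  finally have 3: "z n / A z ^ d \<le> exp (2 * (real d)\<^sup>2 * h / \<kappa>) * (x n / A x ^ d)" .
  have K: "poisson_kernel d x y = Gamma (real d / 2) / pi powr (real d / 2) * (x n / A x ^ d)"
    if "A x > 0" for x
    by (simp only: poisson_kernel_def A P[OF that] n_def[symmetric])
  have "0 \<le> Gamma (real d / 2) / pi powr (real d / 2)"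
    using assms by simp
  from mult_left_mono[OF 3 this] show ?thesis
    by (simp only: K pos mult_ac)
qed

text \<open>
  The kernel is a probability density, so the extension is an average of boundary values.
\<close>
lemma poisson_extension_bound:
  assumes "d \<ge> 1" "x \<in> Rn d" "x (d - 1) > 0" "continuous_on (Rn (d - 1)) g"
    and "\<And>y. y \<in> Rn (d - 1) \<Longrightarrow> \<bar>g y\<bar> \<le> G"
  shows "integrable (leb (d - 1)) (\<lambda>y. g y * poisson_kernel d x y)"
    and "\<bar>poisson_extension d g x\<bar> \<le> G"
proof -
  note K = integrable_poisson_kernel[of d x, OF assms(1-3)]
  have nn: "poisson_kernel d x y \<ge> 0" for y
    using assms by (simp add: poisson_kernel_def)
  note [measurable] = measurable_continuous_on_Rn[OF assms(4)] borel_measurable_integrable[OF K(1)]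
  have b: "\<bar>g y * poisson_kernel d x y\<bar> \<le> G * poisson_kernel d x y" if "y \<in> space (leb (d - 1))" for y
    using that assms(5)[of y] nn[of y] by (simp add: space_leb abs_mult mult_right_mono)
  show I: "integrable (leb (d - 1)) (\<lambda>y. g y * poisson_kernel d x y)"
  proof (rule Bochner_Integration.integrable_bound)
    show "integrable (leb (d - 1)) (\<lambda>y. G * poisson_kernel d x y)" using K by simp
    show "AE y in leb (d - 1). norm (g y * poisson_kernel d x y) \<le> norm (G * poisson_kernel d x y)"
      using b by (intro AE_I2) force
  qed measurable
  have "\<bar>poisson_extension d g x\<bar> \<le> (LINT y|leb (d - 1). \<bar>g y * poisson_kernel d x y\<bar>)"
    unfolding poisson_extension_eq by (rule integral_abs_bound)
  also have "\<dots> \<le> (LINT y|leb (d - 1). G * poisson_kernel d x y)"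
    using I K b by (intro integral_mono) auto
  finally show "\<bar>poisson_extension d g x\<bar> \<le> G" using K by simp
qed

text \<open>
  By the Harnack inequality in both directions, the kernels differ by at most \<open>2 * D\<close> times the
  kernel at \<open>x\<close>, where \<open>D\<close> is its exponent, and the kernel integrates to 1. The condition \<open>D \<le> 1\<close>
  makes \<open>exp D - 1\<close> linear in \<open>D\<close>.
\<close>
lemma poisson_extension_Lipschitz:
  assumes "d \<ge> 1" "x \<in> Rn d" "z \<in> Rn d" "continuous_on (Rn (d - 1)) g"
    and "\<And>y. y \<in> Rn (d - 1) \<Longrightarrow> \<bar>g y\<bar> \<le> G"
    and "0 < \<kappa>" "\<kappa> \<le> 1" "\<kappa> \<le> x (d - 1)" "\<kappa> \<le> z (d - 1)" "h \<ge> 0"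
    and "\<And>i. i < d \<Longrightarrow> \<bar>x i - z i\<bar> \<le> h" and "2 * (real d)\<^sup>2 * h / \<kappa> \<le> 1"
  shows "\<bar>poisson_extension d g x - poisson_extension d g z\<bar> \<le> 4 * G * (real d)\<^sup>2 * h / \<kappa>"
proof -
  define D where "D = 2 * (real d)\<^sup>2 * h / \<kappa>"
  have D: "0 \<le> D" "D \<le> 1" using assms by (auto simp: D_def)
  have G: "G \<ge> 0"
    using assms(5)[of "restrict (\<lambda>_. 0) {..<d-1}"] by (fastforce simp: Rn_def)
  have t: "x (d - 1) > 0" "z (d - 1) > 0" using assms by auto
  note Kx = integrable_poisson_kernel[of d x, OF assms(1) assms(2) t(1)]
  note Bx = poisson_extension_bound[of d x g, OF assms(1) assms(2) t(1) assms(4,5)]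
  note Bz = poisson_extension_bound[of d z g, OF assms(1) assms(3) t(2) assms(4,5)]
  have expD: "exp D - 1 \<le> 2 * D"
    using exp_bound[of D] D mult_left_le[of D D] by (simp add: power2_eq_square)
  have k: "\<bar>poisson_kernel d x y - poisson_kernel d z y\<bar> \<le> 2 * D * poisson_kernel d x y" for y
  proof -
    let ?a = "poisson_kernel d x y" and ?b = "poisson_kernel d z y"
    have nn: "?a \<ge> 0" "?b \<ge> 0" using t assms by (auto simp: poisson_kernel_def)
    have 1: "?b \<le> exp D * ?a"
      unfolding D_def using assms by (intro poisson_kernel_Harnack) auto
    have 2: "?a \<le> exp D * ?b"
      unfolding D_def using assms by (intro poisson_kernel_Harnack) (auto simp: abs_minus_commute)
    have "?b - ?a \<le> (exp D - 1) * ?a" using 1 by (simp add: algebra_simps)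
    moreover have "?a - ?b \<le> (exp D - 1) * ?a"
    proof (cases "?a \<le> ?b")
      case True
      moreover have "0 \<le> (exp D - 1) * ?a" using D nn by simp
      ultimately show ?thesis by linarith
    next
      case False
      have "?a - ?b \<le> (exp D - 1) * ?b" using 2 by (simp add: algebra_simps)
      also have "\<dots> \<le> (exp D - 1) * ?a" using False D by (intro mult_left_mono) auto
      finally show ?thesis .
    qed
    ultimately have "\<bar>?a - ?b\<bar> \<le> (exp D - 1) * ?a" by linarith
    also have "\<dots> \<le> 2 * D * ?a" using expD nn by (intro mult_right_mono)
    finally show ?thesis .
  qed
  have "\<bar>poisson_extension d g x - poisson_extension d g z\<bar> =
      \<bar>LINT y|leb (d - 1). g y * poisson_kernel d x y - g y * poisson_kernel d z y\<bar>"
    unfolding poisson_extension_eq using Bx Bz by simp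
  also have "\<dots> \<le> (LINT y|leb (d - 1). \<bar>g y * poisson_kernel d x y - g y * poisson_kernel d z y\<bar>)"
    by (rule integral_abs_bound)
  also have "\<dots> \<le> (LINT y|leb (d - 1). G * (2 * D) * poisson_kernel d x y)"
  proof (rule integral_mono)
    fix y assume y: "y \<in> space (leb (d - 1))"
    have "\<bar>g y * poisson_kernel d x y - g y * poisson_kernel d z y\<bar> =
        \<bar>g y\<bar> * \<bar>poisson_kernel d x y - poisson_kernel d z y\<bar>"
      by (simp add: right_diff_distrib[symmetric] abs_mult)
    also have "\<dots> \<le> G * (2 * D * poisson_kernel d x y)"
      using y assms(5) G k by (intro mult_mono) (auto simp: space_leb)
    finally show "\<bar>g y * poisson_kernel d x y - g y * poisson_kernel d z y\<bar> \<le> G * (2 * D) * poisson_kernel d x y"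
      by (simp add: mult_ac)
  qed (use Bx Bz Kx in auto)
  also have "\<dots> = 4 * G * (real d)\<^sup>2 * h / \<kappa>"
    using Kx by (simp add: D_def)
  finally show ?thesis .
qed

section \<open>Polynomial cost\<close>

lemma poisson_extension_approximation:
  assumes "1 \<le> p" "0 < \<kappa>" "\<kappa> < 1" "2 \<le> d" "0 < \<epsilon>" "\<epsilon> \<le> 1" "1 \<le> G"
    and "continuous_on (Rn (d - 1)) g" "\<And>y. y \<in> Rn (d - 1) \<Longrightarrow> \<bar>g y\<bar> \<le> G"
  shows "\<exists>\<Psi>. finite_expression d \<Psi> \<and>
           Lp_approximates p d (slab d \<kappa>) (poisson_extension d g) \<epsilon> \<Psi> \<and>
           real (fex_cost \<Psi>) \<le> 16 * real d * (16 * G * (real d)\<^sup>2 / (\<kappa> * \<epsilon>) + 1) + 6"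
proof -
  (* chosen such that the Lipschitz bound with step 1 / N is at most \<epsilon> / 4 *)
  define N where "N = nat \<lceil>16 * G * (real d)\<^sup>2 / (\<kappa> * \<epsilon>)\<rceil>"
  have d1: "d \<ge> 1" using assms(4) by simp
  have pos: "16 * G * (real d)\<^sup>2 / (\<kappa> * \<epsilon>) > 0" using assms(2,4,5,7) by simp
  hence N: "real N \<ge> 16 * G * (real d)\<^sup>2 / (\<kappa> * \<epsilon>)"
    "real N \<le> 16 * G * (real d)\<^sup>2 / (\<kappa> * \<epsilon>) + 1"
    unfolding N_def by linarith+
  have N0: "N > 0" using N(1) pos by linarith
  have step: "4 * G * (real d)\<^sup>2 * (1 / N) / \<kappa> \<le> \<epsilon> / 4"
    using N(1) N0 assms(2,5) by (simp add: field_simps)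
  have small: "2 * (real d)\<^sup>2 * (1 / N) / \<kappa> \<le> 1"
  proof -
    let ?a = "(real d)\<^sup>2 * (1 / N) / \<kappa>"
    have "0 \<le> ?a" using assms(2) by simp
    moreover from assms(7) this have "1 * ?a \<le> G * ?a"
      by (rule mult_right_mono)
    moreover have "4 * (G * ?a) = 4 * G * (real d)\<^sup>2 * (1 / N) / \<kappa>"
      by simp
    with step assms(5,6) have "4 * (G * ?a) \<le> 1" by linarith
    ultimately have "2 * ?a \<le> 1" by linarith
    thus ?thesis by simp
  qed
  have bound: "\<bar>poisson_extension d g x\<bar> \<le> G" if "x \<in> slab d \<kappa>" for x
  proof -
    have "0 < x (d - 1)" using slab_memD(2)[OF that d1] assms(2) by linarith
    from poisson_extension_bound(2)[where d = d and x = x and g = g and G = G, OF d1 slab_memD(1)[OF that d1] this assms(8,9)] show ?thesis .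
  qed
  have modulus: "\<bar>poisson_extension d g x - poisson_extension d g z\<bar> \<le> \<epsilon> / 4"
    if x: "x \<in> slab d \<kappa>" and z: "z \<in> slab d \<kappa>"
      and close: "\<And>i. i < d \<Longrightarrow> \<bar>x i - z i\<bar> \<le> 1 / real N" for x z
  proof -
    have "\<kappa> \<le> 1" "0 \<le> 1 / real N" using assms(3) by simp_all
    note poisson_extension_Lipschitz[where d = d and x = x and z = z and g = g and G = G and
        \<kappa> = \<kappa> and h = "1 / real N", OF d1 slab_memD(1)[OF x d1] slab_memD(1)[OF z d1] assms(8,9,2) this(1)
        slab_memD(2)[OF x d1] slab_memD(2)[OF z d1] this(2) close small]
    also note step
    finally show ?thesis .
  qed
  have "0 < G" using assms(7) by simp
  have "\<exists>\<Psi>. finite_expression d \<Psi> \<and> Lp_approximates p d (slab d \<kappa>) (poisson_extension d g) \<epsilon> \<Psi> \<and>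
      fex_cost \<Psi> = 16 * d * N + 6"
    by (rule Lp_approximation_on_slab[OF assms(1-3,5) \<open>0 < G\<close> N0])
       (fact measurable_poisson_extension[OF d1 assms(8)], fact bound, fact modulus)
  then obtain \<Psi> where \<Psi>: "finite_expression d \<Psi>"
    "Lp_approximates p d (slab d \<kappa>) (poisson_extension d g) \<epsilon> \<Psi>" "fex_cost \<Psi> = 16 * d * N + 6"
    by (elim exE conjE)
  have "real (fex_cost \<Psi>) \<le> 16 * real d * (16 * G * (real d)\<^sup>2 / (\<kappa> * \<epsilon>) + 1) + 6"
    using mult_left_mono[OF N(2), of "16 * real d"] unfolding \<Psi>(3) by simp
  with \<Psi>(1,2) show ?thesis by (intro exI[of _ \<Psi>] conjI)
qed

theorem theorem7p1:
  fixes p \<rho> \<kappa> Cg \<beta> \<gamma> :: real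
  assumes "1 \<le> p" and "0 < \<rho>" and "\<rho> \<le> 1" and "0 < \<kappa>" and "\<kappa> < 1"
    and "1 \<le> Cg" and "0 \<le> \<beta>" and "0 \<le> \<gamma>"
  shows "\<exists>C>0. \<exists>\<alpha>>0. \<forall>g :: nat \<Rightarrow> (nat \<Rightarrow> real) \<Rightarrow> real.
    (\<forall>d\<ge>2. boundary_data \<rho> Cg \<beta> \<gamma> d (g d)) \<longrightarrow>
      (\<forall>d\<ge>2. \<forall>\<epsilon>. 0 < \<epsilon> \<and> \<epsilon> \<le> 1 \<longrightarrow>
        (\<exists>\<Psi>. finite_expression d \<Psi> \<and>
             Lp_approximates p d (slab d \<kappa>) (poisson_extension d (g d)) \<epsilon> \<Psi> \<and>
             real (fex_cost \<Psi>) \<le> C * real d powr \<alpha> * \<epsilon> powr (- \<alpha>))) \<and>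
      (\<exists>Q :: real poly poly. \<forall>d\<ge>2. \<forall>\<epsilon>. 0 < \<epsilon> \<and> \<epsilon> \<le> 1 \<longrightarrow>
        (\<exists>\<Psi>. finite_expression d \<Psi> \<and>
             Lp_approximates p d (slab d \<kappa>) (poisson_extension d (g d)) \<epsilon> \<Psi> \<and>
             real (fex_cost \<Psi>) \<le> poly (poly Q [:real d:]) (1 / \<epsilon>)))"
proof -
  (* the cost is of order d * G * d^2 / \<epsilon> with G = Cg * d powr \<beta>; an integer exponent also serves
     the polynomial bound *)
  define k where "k = nat \<lceil>\<beta>\<rceil> + 3"
  define C where "C = 256 * Cg / \<kappa> + 22"
  have C: "C > 0" using assms by (simp add: C_def add_pos_pos)
  have main: "\<exists>\<Psi>. finite_expression d \<Psi> \<and>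
             Lp_approximates p d (slab d \<kappa>) (poisson_extension d g) \<epsilon> \<Psi> \<and>
             real (fex_cost \<Psi>) \<le> C * real d ^ k * (1 / \<epsilon>) ^ k"
    if g: "boundary_data \<rho> Cg \<beta> \<gamma> d g" and d: "2 \<le> d" and e: "0 < \<epsilon>" "\<epsilon> \<le> 1"
    for d g \<epsilon>
  proof -
    define X where "X = real d ^ k * (1 / \<epsilon>) ^ k"
    have "1 \<le> 1 / \<epsilon>" using e by simp
    hence inv: "1 / \<epsilon> \<le> (1 / \<epsilon>) ^ k" "1 \<le> (1 / \<epsilon>) ^ k"
      using power_increasing[of 1 k "1 / \<epsilon>"] by (auto simp: k_def intro!: one_le_power)
    have G: "1 \<le> Cg * real d powr \<beta>"
      using assms d mult_mono[of 1 Cg 1 "real d powr \<beta>"] by (simp add: ge_one_powr_ge_zero)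
    have "real d powr \<beta> \<le> real d powr real (nat \<lceil>\<beta>\<rceil>)"
      using d by (intro powr_mono) linarith+
    hence "real d powr \<beta> * real d ^ 3 \<le> real d ^ k"
      using d by (simp add: k_def power_add powr_realpow mult_right_mono)
    hence 1: "(real d powr \<beta> * real d ^ 3) * (1 / \<epsilon>) \<le> X"
      unfolding X_def using inv e by (intro mult_mono) auto
    have "real d ^ 1 \<le> real d ^ k"
      using d by (intro power_increasing) (auto simp: k_def)
    hence 2: "real d * 1 \<le> X"
      unfolding X_def using inv e by (intro mult_mono) auto
    obtain \<Psi> where \<Psi>: "finite_expression d \<Psi>"
        "Lp_approximates p d (slab d \<kappa>) (poisson_extension d g) \<epsilon> \<Psi>"
      and cost: "real (fex_cost \<Psi>) \<le>
        16 * real d * (16 * (Cg * real d powr \<beta>) * (real d)\<^sup>2 / (\<kappa> * \<epsilon>) + 1) + 6"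
      using poisson_extension_approximation[OF assms(1,4,5) d e G, of g] g
      by (auto simp: boundary_data_def)
    note cost
    also have "16 * real d * (16 * (Cg * real d powr \<beta>) * (real d)\<^sup>2 / (\<kappa> * \<epsilon>) + 1) + 6 =
        256 * Cg / \<kappa> * ((real d powr \<beta> * real d ^ 3) * (1 / \<epsilon>)) + 16 * (real d * 1) + 6"
      using assms e by (simp add: field_simps power2_eq_square power3_eq_cube)
    also have "\<dots> \<le> 256 * Cg / \<kappa> * X + 16 * X + 6 * X"
      using 1 2 d assms by (intro add_mono mult_left_mono) auto
    also have "\<dots> = C * real d ^ k * (1 / \<epsilon>) ^ k"
      by (simp add: C_def X_def algebra_simps)
    finally show ?thesis using \<Psi> by blast
  qed
  have powr: "C * real d ^ k * (1 / \<epsilon>) ^ k = C * real d powr real k * \<epsilon> powr (- real k)"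
    if "2 \<le> d" "0 < \<epsilon>" for d \<epsilon>
    using that by (simp add: powr_realpow powr_minus divide_inverse power_inverse)
  have poly: "poly (poly (monom (monom C k) k) [:real d:]) (1 / \<epsilon>) = C * real d ^ k * (1 / \<epsilon>) ^ k"
    for d \<epsilon>
    by (simp add: poly_monom)
  show ?thesis
  proof (rule exI[of _ C], rule conjI[OF C], rule exI[of _ "real k"], intro conjI allI impI)
    show "0 < real k" by (simp add: k_def)
  next
    fix g :: "nat \<Rightarrow> (nat \<Rightarrow> real) \<Rightarrow> real" and d :: nat and \<epsilon> :: real
    assume g: "\<forall>d\<ge>2. boundary_data \<rho> Cg \<beta> \<gamma> d (g d)" and d: "2 \<le> d" and e: "0 < \<epsilon> \<and> \<epsilon> \<le> 1"
    show "\<exists>\<Psi>. finite_expression d \<Psi> \<and>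
             Lp_approximates p d (slab d \<kappa>) (poisson_extension d (g d)) \<epsilon> \<Psi> \<and>
             real (fex_cost \<Psi>) \<le> C * real d powr real k * \<epsilon> powr (- real k)"
      using main[OF g[rule_format, OF d] d conjunct1[OF e] conjunct2[OF e]]
      unfolding powr[OF d conjunct1[OF e]] .
  next
    fix g :: "nat \<Rightarrow> (nat \<Rightarrow> real) \<Rightarrow> real"
    assume g: "\<forall>d\<ge>2. boundary_data \<rho> Cg \<beta> \<gamma> d (g d)"
    show "\<exists>Q :: real poly poly. \<forall>d\<ge>2. \<forall>\<epsilon>. 0 < \<epsilon> \<and> \<epsilon> \<le> 1 \<longrightarrow>
        (\<exists>\<Psi>. finite_expression d \<Psi> \<and>
             Lp_approximates p d (slab d \<kappa>) (poisson_extension d (g d)) \<epsilon> \<Psi> \<and>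
             real (fex_cost \<Psi>) \<le> poly (poly Q [:real d:]) (1 / \<epsilon>))"
    proof (rule exI[of _ "monom (monom C k) k"], intro allI impI, unfold poly)
      fix d :: nat and \<epsilon> :: real
      assume d: "2 \<le> d" and e: "0 < \<epsilon> \<and> \<epsilon> \<le> 1"
      show "\<exists>\<Psi>. finite_expression d \<Psi> \<and>
             Lp_approximates p d (slab d \<kappa>) (poisson_extension d (g d)) \<epsilon> \<Psi> \<and>
             real (fex_cost \<Psi>) \<le> C * real d ^ k * (1 / \<epsilon>) ^ k"
        using main[OF g[rule_format, OF d] d conjunct1[OF e] conjunct2[OF e]] .
    qed
  qed
qed

end
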